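(* Let $\Sigma_3$ be the system on $\mathbb{R}^2$ with inputs $u=(u_1,u_2)\in\mathbb{R}^2$ given by $$\dot x_1=-x_1+x_2+u_1,\qquad \dot x_2=3x_2^{4/3}\,(-x_1-x_2+u_2),$$ and let $V_3:\mathbb{R}^2\to\mathbb{R}_{\ge 0}$, $V_3(x_1,x_2)=x_1^2+x_2^{2/3}$. Then $V_3\in\mathcal{W}_\infty(\Sigma_3,1)$. On the other hand, if $V$ is any locally Lipschitz function in $\mathcal{W}(\Sigma_3,1)$, then $V$ is not positive definite and $V$ is not proper.
   Context: Notation: $|\cdot|$ is the Euclidean norm; fractional powers of real numbers are real powers via the real cube root, so $r^{4/3}=|r|^{4/3}$ and $r^{2/3}=|r|^{2/3}$ for $r\in\mathbb{R}$. For $V:\mathbb{R}^n\to\mathbb{R}$ and $x\in\mathbb{R}^n$, the viscosity subdifferential $\partial_D V(x)$ is the (possibly empty) set of all $\zeta\in\mathbb{R}^n$ such that $$\liminf_{h\to 0}\frac{1}{|h|}\left[V(x+h)-V(x)-\zeta\cdot h\right]\ge 0 .$$ For a system $\Sigma:\ \dot x=F(x,u)$ with $x\in\mathbb{R}^n$, $u\in\mathcal{U}$, and $\gamma\ge 0$, $\mathcal{W}(\Sigma,\gamma)$ is the set of all continuous $V:\mathbb{R}^n\to\mathbb{R}_{\ge0}$ such that $$\zeta\cdot F(x,u)\le -|x|^2+\gamma|u|^2\quad\text{for all }x\in\mathbb{R}^n\setminus\{0\},\ u\in\mathcal{U},\ \zeta\in\partial_D V(x).$$ A continuous $V:\mathbb{R}^n\to\mathbb{R}_{\ge0}$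 is proper if $\{x: V(x)\le a\}$ is compact for every $a>0$, and positive definite if $V(x)=0$ if and only if $x=0$. $\mathcal{W}_\infty(\Sigma,\gamma)$ is the set of $V\in\mathcal{W}(\Sigma,\gamma)$ that are proper and positive definite. Here $n=2$ and $\mathcal{U}=\mathbb{R}^2$. *)

theory Defs
  imports "HOL-Analysis.Analysis"
begin

definition visc_subdiff :: "(real^'n \<Rightarrow> real) \<Rightarrow> real^'n \<Rightarrow> (real^'n) set" where
  "visc_subdiff V x =
     {\<zeta>. Liminf (at 0) (\<lambda>h. ereal ((V (x + h) - V x - \<zeta> \<bullet> h) / norm h)) \<ge> 0}"

text \<open>
  A system \<open>x' = F(x,u)\<close> with inputs \<open>u\<close> in \<open>U\<close> is represented by its right-hand
  side \<open>F\<close> and the input value set \<open>U\<close>.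
\<close>

definition dissip_set ::
  "(real^'n \<Rightarrow> real^'m \<Rightarrow> real^'n) \<Rightarrow> (real^'m) set \<Rightarrow> real \<Rightarrow> (real^'n \<Rightarrow> real) set" where
  "dissip_set F U \<gamma> =
     {V. continuous_on UNIV V \<and> (\<forall>x. 0 \<le> V x) \<and>
         (\<forall>x\<in>UNIV - {0}. \<forall>u\<in>U. \<forall>\<zeta>\<in>visc_subdiff V x.
            \<zeta> \<bullet> F x u \<le> - (norm x)\<^sup>2 + \<gamma> * (norm u)\<^sup>2)}"

definition proper_fun :: "(real^'n \<Rightarrow> real) \<Rightarrow> bool" where
  "proper_fun V \<longleftrightarrow> (\<forall>a>0. compact {x. V x \<le> a})"

definition pos_definite :: "(real^'n \<Rightarrow> real) \<Rightarrow> bool" where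
  "pos_definite V \<longleftrightarrow> (\<forall>x. V x = 0 \<longleftrightarrow> x = 0)"

definition dissip_set_inf ::
  "(real^'n \<Rightarrow> real^'m \<Rightarrow> real^'n) \<Rightarrow> (real^'m) set \<Rightarrow> real \<Rightarrow> (real^'n \<Rightarrow> real) set" where
  "dissip_set_inf F U \<gamma> = {V \<in> dissip_set F U \<gamma>. proper_fun V \<and> pos_definite V}"

definition locally_lipschitz :: "(real^'n \<Rightarrow> real) \<Rightarrow> bool" where
  "locally_lipschitz V \<longleftrightarrow> (\<forall>x. \<exists>S L. open S \<and> x \<in> S \<and> L-lipschitz_on S V)"

text \<open>
  The powers with exponents \<open>4/3\<close> and \<open>2/3\<close> are taken via the real cube root, which
  is defined on all of the reals (whereas \<open>powr\<close> is not meaningful for negative bases).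
\<close>

definition Sigma3 :: "real^2 \<Rightarrow> real^2 \<Rightarrow> real^2" where
  "Sigma3 x u = vector [- x$1 + x$2 + u$1,
                        3 * root 3 (x$2) ^ 4 * (- x$1 - x$2 + u$2)]"

definition V3 :: "real^2 \<Rightarrow> real" where
  "V3 x = (x$1)\<^sup>2 + (root 3 (x$2))\<^sup>2"

lemma root3_power_eq_powr:
  "root 3 r ^ 4 = \<bar>r\<bar> powr (4/3)" "root 3 r ^ 2 = \<bar>r\<bar> powr (2/3)"
proof -
  have r: "\<bar>root 3 r\<bar> = \<bar>r\<bar> powr (1/3)"
    by (simp add: real_root_abs [symmetric] root_powr_inverse)
  have p: "\<bar>root 3 r\<bar> ^ n = \<bar>r\<bar> powr (n/3)" if "n > 0" for n :: nat
    using that by (cases "r = 0") (simp_all add: r powr_power)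
  show "root 3 r ^ 4 = \<bar>r\<bar> powr (4/3)" using p [of 4] by (simp add: power_even_abs)
  show "root 3 r ^ 2 = \<bar>r\<bar> powr (2/3)" using p [of 2] by simp
qed

end

theory Submission
  imports Defs
begin

text \<open>
  The first claim is a completion of squares: away from the axis \<open>x\<^sub>2 = 0\<close> the function \<open>V3\<close> is
  differentiable, and on the axis the second component of \<open>Sigma3\<close> vanishes, so that only
  \<open>\<zeta>\<^sub>1 = 2 x\<^sub>1\<close> matters.

  The second claim holds because there is no locally Lipschitz \<open>V\<close> in the dissipation set at all.
  Testing the inequality with \<open>u = (\<zeta>\<^sub>1/2, 0)\<close> gives
  \<open>(\<zeta>\<^sub>1/2 - (x\<^sub>1 - x\<^sub>2))\<^sup>2 + 2 x\<^sub>1 x\<^sub>2 \<le> 3 \<zeta>\<^sub>2 x\<^sub>2\<^bsup>4/3\<^esup> (x\<^sub>1 + x\<^sub>2)\<close>, which fails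
  for \<open>x\<^sub>1\<close> near 1, small \<open>x\<^sub>2 > 0\<close> and bounded \<open>\<zeta>\<^sub>2\<close>. But a Lipschitz function has bounded
  subgradients at some points of every ball.
\<close>

section \<open>Viscosity subgradients\<close>

text \<open>Clearing the division by \<open>norm h\<close> turns the extended-real liminf into an
  epsilon condition that can be pulled back along a ray or verified by hand.\<close>

lemma visc_subdiff_iff:
  "\<zeta> \<in> visc_subdiff V x \<longleftrightarrow>
     (\<forall>e>0. \<forall>\<^sub>F h in at 0. - e * norm h \<le> V (x + h) - V x - \<zeta> \<bullet> h)"
proof
  assume \<zeta>: "\<zeta> \<in> visc_subdiff V x"
  show "\<forall>e>0. \<forall>\<^sub>F h in at 0. - e * norm h \<le> V (x + h) - V x - \<zeta> \<bullet> h"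
  proof (intro allI impI)
    fix e :: real assume "e > 0"
    then have "ereal (- e) < 0" by simp
    with \<zeta> have "\<forall>\<^sub>F h in at 0. ereal (- e) < ereal ((V (x + h) - V x - \<zeta> \<bullet> h) / norm h)"
      unfolding visc_subdiff_def le_Liminf_iff by blast
    moreover have "\<forall>\<^sub>F h in at 0. h \<noteq> (0 :: real^'a)"
      by (simp add: eventually_at_filter)
    ultimately show "\<forall>\<^sub>F h in at 0. - e * norm h \<le> V (x + h) - V x - \<zeta> \<bullet> h"
      by eventually_elim (simp add: field_simps)
  qed
next
  assume *: "\<forall>e>0. \<forall>\<^sub>F h in at 0. - e * norm h \<le> V (x + h) - V x - \<zeta> \<bullet> h"
  have "\<forall>\<^sub>F h in at 0. y < ereal ((V (x + h) - V x - \<zeta> \<bullet> h) / norm h)" if y: "y < 0" for y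
  proof -
    \<comment> \<open>The bound \<open>y\<close> may be minus infinity, so a real \<open>z\<close>
      is inserted and \<open>- z\<close> serves as the epsilon.\<close>
    obtain z where z: "y < ereal z" "ereal z < 0"
      using y ereal_dense2 by (metis zero_ereal_def)
    then have "- z > 0" by simp
    with * have "\<forall>\<^sub>F h in at 0. - (- z) * norm h \<le> V (x + h) - V x - \<zeta> \<bullet> h"
      by blast
    moreover have "\<forall>\<^sub>F h in at 0. h \<noteq> (0 :: real^'a)"
      by (simp add: eventually_at_filter)
    ultimately show ?thesis
    proof eventually_elim
      case (elim h)
      then have "z \<le> (V (x + h) - V x - \<zeta> \<bullet> h) / norm h"
        by (simp add: field_simps)
      with z(1) show ?case
        by (meson ereal_less_eq(3) less_le_trans)
    qed
  qed
  then show "\<zeta> \<in> visc_subdiff V x"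
    unfolding visc_subdiff_def le_Liminf_iff by blast
qed

text \<open>Restrict the liminf to increments \<open>t *\<^sub>R v\<close> with \<open>t\<close>
  tending to 0 from the right, where dividing by \<open>t\<close> leaves only the error
  \<open>e * norm v\<close>.\<close>

lemma visc_subdiff_le_directional_deriv:
  assumes \<zeta>: "\<zeta> \<in> visc_subdiff V x"
    and D: "((\<lambda>t. V (x + t *\<^sub>R v)) has_real_derivative D) (at 0)"
  shows "\<zeta> \<bullet> v \<le> D"
proof (cases "v = 0")
  case True
  then have "((\<lambda>t. V (x + t *\<^sub>R v)) has_real_derivative 0) (at 0)" by simp
  with D have "D = 0" using DERIV_unique by blast
  with True show ?thesis by simp
next
  case False
  have lim: "((\<lambda>t. (V (x + t *\<^sub>R v) - V x) / t) \<longlongrightarrow> D) (at_right 0)"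
    using D by (auto simp: DERIV_def intro: filterlim_mono at_le)
  have flt: "filterlim (\<lambda>t. t *\<^sub>R v) (at 0) (at_right (0::real))"
  proof (rule filterlim_atI)
    show "((\<lambda>t. t *\<^sub>R v) \<longlongrightarrow> 0) (at_right (0::real))"
      by (auto intro!: tendsto_eq_intros)
    show "\<forall>\<^sub>F t in at_right (0::real). t *\<^sub>R v \<noteq> 0"
      using False by (auto simp: eventually_at_filter)
  qed
  have "\<zeta> \<bullet> v - e * norm v \<le> D" if "e > 0" for e
  proof (rule tendsto_lowerbound [OF lim])
    have "\<forall>\<^sub>F t in at_right 0. - e * norm (t *\<^sub>R v) \<le> V (x + t *\<^sub>R v) - V x - \<zeta> \<bullet> (t *\<^sub>R v)"
      using \<zeta> that flt unfolding visc_subdiff_iff filterlim_iff by blast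
    moreover have "\<forall>\<^sub>F t in at_right 0. t > (0::real)"
      by (simp add: eventually_at_filter)
    ultimately show "\<forall>\<^sub>F t in at_right 0. \<zeta> \<bullet> v - e * norm v \<le> (V (x + t *\<^sub>R v) - V x) / t"
      by eventually_elim (simp add: field_simps)
  qed simp
  note * = this
  show ?thesis
  proof (rule field_le_epsilon)
    fix e :: real assume "e > 0"
    with * [of "e / norm v"] False show "\<zeta> \<bullet> v \<le> D + e" by simp
  qed
qed

text \<open>The one-sided bound applies to both \<open>v\<close> and \<open>- v\<close>. Only the
  derivative along a line is needed, so this also fixes the first component of a subgradient of
  \<open>V3\<close> on the axis where \<open>V3\<close> is not differentiable.\<close>

lemma visc_subdiff_eq_directional_deriv:
  assumes "\<zeta> \<in> visc_subdiff V x"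
    and D: "((\<lambda>t. V (x + t *\<^sub>R v)) has_real_derivative D) (at 0)"
  shows "\<zeta> \<bullet> v = D"
proof (rule antisym)
  have "((\<lambda>t. V (x + (- t) *\<^sub>R v)) has_real_derivative - D) (at 0)"
    using DERIV_chain2 [of "\<lambda>t. V (x + t *\<^sub>R v)" D uminus 0 "-1" UNIV] D
      DERIV_minus [OF DERIV_ident, of 0 UNIV] by simp
  then show "D \<le> \<zeta> \<bullet> v"
    using visc_subdiff_le_directional_deriv [OF assms(1), of "- v" "- D"] by simp
qed (rule visc_subdiff_le_directional_deriv [OF assms])

text \<open>Minimize \<open>V\<close> plus a quadratic penalty over the ball. At an interior
  minimizer, minus the gradient of the penalty is a subgradient of \<open>V\<close>. The bound does
  not depend on \<open>r\<close>, so the ball may be shrunk freely.\<close>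

lemma lipschitz_bounded_visc_subgradient:
  assumes lip: "L-lipschitz_on (cball c r) V" and r: "r > 0"
  obtains x \<zeta> where "x \<in> ball c r" "\<zeta> \<in> visc_subdiff V x" "norm \<zeta> \<le> 2 * L"
proof -
  have L: "L \<ge> 0" using lip by (rule lipschitz_on_nonneg)
  \<comment> \<open>The minimizer will satisfy \<open>K * norm (x - c) \<le> L\<close>. The added 1
    makes \<open>L < K * r\<close> strict, which forces it into the open ball.\<close>
  define K where "K = (L + 1) / r"
  have K: "K > 0" "L < K * r" using L r by (auto simp: K_def)
  define f where "f y = V y + K * (norm (y - c))\<^sup>2" for y
  have "continuous_on (cball c r) f"
    unfolding f_def by (intro continuous_intros lipschitz_on_continuous_on [OF lip])
  then obtain x where x: "x \<in> cball c r" and min: "\<And>y. y \<in> cball c r \<Longrightarrow> f x \<le> f y"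
    using continuous_attains_inf [of "cball c r" f] r by auto
  have "K * (norm (x - c))\<^sup>2 \<le> V c - V x"
    using min [of c] r by (simp add: f_def)
  also have "\<dots> \<le> L * norm (x - c)"
    using lipschitz_onD [OF lip, of c x] x r by (simp add: dist_norm norm_minus_commute)
  finally have bound: "K * norm (x - c) \<le> L"
    using L by (cases "x = c") (auto simp: power2_eq_square)
  with K have "K * norm (x - c) < K * r" by linarith
  with K have ball: "x \<in> ball c r" by (simp add: dist_norm norm_minus_commute)
  define \<zeta> where "\<zeta> = (- 2 * K) *\<^sub>R (x - c)"
  have norm: "norm \<zeta> \<le> 2 * L"
    using K bound by (simp add: \<zeta>_def abs_mult)
  obtain d where d: "d > 0" "ball x d \<subseteq> ball c r"
    using ball by (metis openE open_ball)
  have "\<zeta> \<in> visc_subdiff V x"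
    unfolding visc_subdiff_iff
  proof (intro allI impI)
    fix e :: real assume e: "e > 0"
    \<comment> \<open>Minimality leaves only the second-order error
      \<open>K * (norm h)\<^sup>2\<close>, which \<open>e * norm h\<close> absorbs once
      \<open>norm h < e / K\<close>.\<close>
    have "- e * norm h \<le> V (x + h) - V x - \<zeta> \<bullet> h" if h: "norm h < d" "norm h < e / K" for h
    proof -
      have "x + h \<in> ball x d" using h by (simp add: dist_norm)
      then have "x + h \<in> cball c r" using d by auto
      then have "f x \<le> f (x + h)" by (rule min)
      moreover have "(norm (x + h - c))\<^sup>2 = (norm (x - c))\<^sup>2 + 2 * ((x - c) \<bullet> h) + (norm h)\<^sup>2"
        unfolding power2_norm_eq_inner by (simp add: inner_commute algebra_simps)
      ultimately have "V x + K * (norm (x - c))\<^sup>2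
          \<le> V (x + h) + K * ((norm (x - c))\<^sup>2 + 2 * ((x - c) \<bullet> h) + (norm h)\<^sup>2)"
        by (simp add: f_def)
      then have "- (K * (norm h)\<^sup>2) \<le> V (x + h) - V x - \<zeta> \<bullet> h"
        by (simp add: \<zeta>_def algebra_simps)
      moreover have "K * norm h * norm h \<le> e * norm h"
        using h K by (intro mult_right_mono) (auto simp: field_simps)
      ultimately show ?thesis by (simp add: power2_eq_square)
    qed
    then show "\<forall>\<^sub>F h in at 0. - e * norm h \<le> V (x + h) - V x - \<zeta> \<bullet> h"
      using d(1) e K by (auto simp: eventually_at intro!: exI [of _ "min d (e / K)"])
  qed
  from ball this norm show thesis by (rule that)
qed

section \<open>The system and the function \<open>V3\<close>\<close>

lemma norm_power2_vec2: "(norm (x :: real^2))\<^sup>2 = (x$1)\<^sup>2 + (x$2)\<^sup>2"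
  unfolding power2_norm_eq_inner by (simp add: inner_vec_def sum_2 power2_eq_square)

lemma inner_Sigma3:
  "\<zeta> \<bullet> Sigma3 x u = \<zeta>$1 * (- x$1 + x$2 + u$1)
     + \<zeta>$2 * (3 * root 3 (x$2) ^ 4 * (- x$1 - x$2 + u$2))"
  by (simp add: Sigma3_def inner_vec_def sum_2)

lemma visc_subdiff_V3_1:
  assumes "\<zeta> \<in> visc_subdiff V3 x"
  shows "\<zeta>$1 = 2 * x$1"
proof -
  have "((\<lambda>t. V3 (x + t *\<^sub>R axis 1 1)) has_real_derivative 2 * x$1) (at 0)"
    unfolding V3_def by (auto simp: axis_def intro!: derivative_eq_intros)
  from visc_subdiff_eq_directional_deriv [OF assms this] show ?thesis
    by (simp add: inner_axis)
qed

lemma visc_subdiff_V3_2: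
  assumes "\<zeta> \<in> visc_subdiff V3 x" and nz: "x$2 \<noteq> 0"
  shows "\<zeta>$2 = 2 / (3 * root 3 (x$2))"
proof -
  have "((\<lambda>t. root 3 (x$2 + t)) has_real_derivative inverse (3 * root 3 (x$2) ^ 2)) (at 0)"
    using DERIV_odd_real_root [of 3 "x$2"] nz DERIV_shift [of "root 3" _ 0 "x$2"]
    by (simp add: add.commute [of _ "x$2"])
  from DERIV_add [OF DERIV_const [of "(x$1)\<^sup>2"] DERIV_power [OF this, of 2]]
  have "((\<lambda>t. V3 (x + t *\<^sub>R axis 2 1)) has_real_derivative
      2 * root 3 (x$2) * inverse (3 * root 3 (x$2) ^ 2)) (at 0)"
    unfolding V3_def by (simp add: axis_def ac_simps)
  from visc_subdiff_eq_directional_deriv [OF assms(1) this] show ?thesis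
    using nz by (simp add: inner_axis field_simps power2_eq_square)
qed

lemma continuous_on_V3: "continuous_on A V3"
  unfolding V3_def by (intro continuous_intros)

lemma V3_in_dissip_set: "V3 \<in> dissip_set Sigma3 UNIV 1"
proof -
  have "\<zeta> \<bullet> Sigma3 x u \<le> - (norm x)\<^sup>2 + (norm u)\<^sup>2" if \<zeta>: "\<zeta> \<in> visc_subdiff V3 x" for x u \<zeta>
  proof -
    define r where "r = root 3 (x$2)"
    have r3: "r ^ 3 = x$2" by (simp add: r_def odd_real_root_pow)
    \<comment> \<open>Off the axis the second component is \<open>2 / (3 * r)\<close>, giving
      \<open>2 * r ^ 3\<close>. On the axis both sides vanish, whatever that component is.\<close>
    have "\<zeta>$2 * (3 * r ^ 4) = 2 * x$2"
    proof (cases "x$2 = 0")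
      case False
      then have "r \<noteq> 0" by (simp add: r_def)
      with visc_subdiff_V3_2 [OF \<zeta> False] show ?thesis
        unfolding r_def [symmetric] unfolding r3 [symmetric] by (simp add: field_simps eval_nat_numeral)
    qed (simp add: r_def)
    then have "\<zeta> \<bullet> Sigma3 x u
        = 2 * x$1 * (- x$1 + x$2 + u$1) + 2 * x$2 * (- x$1 - x$2 + u$2)"
      using visc_subdiff_V3_1 [OF \<zeta>]
      by (simp add: inner_Sigma3 r_def [symmetric] mult.assoc [symmetric])
    \<comment> \<open>The cross terms in \<open>x$1 * x$2\<close> cancel, so each coordinate
      completes its own square.\<close>
    also have "\<dots> = - (norm x)\<^sup>2 + (norm u)\<^sup>2 - (x$1 - u$1)\<^sup>2 - (x$2 - u$2)\<^sup>2"
      unfolding norm_power2_vec2 by (simp add: power2_eq_square algebra_simps)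
    also have "\<dots> \<le> - (norm x)\<^sup>2 + (norm u)\<^sup>2" by simp
    finally show ?thesis .
  qed
  then show ?thesis
    by (auto simp: dissip_set_def continuous_on_V3) (simp add: V3_def)
qed

lemma pos_definite_V3: "pos_definite V3"
  unfolding pos_definite_def V3_def
  by (auto simp: vec_eq_iff forall_2)

lemma proper_fun_V3: "proper_fun V3"
  unfolding proper_fun_def
proof (intro allI impI)
  fix a :: real assume "a > 0"
  have "closed {x. V3 x \<le> a}"
    using continuous_on_V3 by (intro closed_Collect_le) auto
  \<comment> \<open>The cube comes from recovering \<open>x$2\<close> from its cube root.\<close>
  moreover have "norm x \<le> sqrt a + sqrt a ^ 3" if "V3 x \<le> a" for x
  proof -
    have "(x$1)\<^sup>2 \<le> a" "(root 3 (x$2))\<^sup>2 \<le> a"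
      using that unfolding V3_def by (smt (verit) zero_le_power2)+
    then have 1: "\<bar>x$1\<bar> \<le> sqrt a" and 2: "\<bar>root 3 (x$2)\<bar> \<le> sqrt a"
      by (auto intro: real_le_rsqrt)
    have "\<bar>root 3 (x$2)\<bar> ^ 3 \<le> sqrt a ^ 3"
      using 2 by (intro power_mono) auto
    then have "\<bar>x$2\<bar> \<le> sqrt a ^ 3"
      by (simp add: power_abs [symmetric] odd_real_root_pow)
    with 1 show ?thesis
      using norm_le_l1_cart [of x] by (simp add: sum_2)
  qed
  then have "bounded {x. V3 x \<le> a}" by (auto intro: boundedI)
  ultimately show "compact {x. V3 x \<le> a}"
    by (simp add: compact_eq_bounded_closed)
qed

section \<open>Nonexistence of locally Lipschitz members\<close>

text \<open>With \<open>x$2 = r ^ 3\<close>, the test inequality forces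
  \<open>2 * x$1 * r ^ 3\<close> below \<open>12 * L * x$1 * r ^ 4\<close>, hence
  \<open>1 \<le> 6 * L * r\<close>, which fails for small \<open>r\<close>.\<close>

lemma locally_lipschitz_not_in_dissip_set:
  assumes lip: "locally_lipschitz V"
  shows "V \<notin> dissip_set Sigma3 UNIV 1"
proof
  assume V: "V \<in> dissip_set Sigma3 UNIV 1"
  define p :: "real^2" where "p = vector [1, 0]"
  obtain S L where S: "open S" "p \<in> S" and lipS: "L-lipschitz_on S V"
    using lip unfolding locally_lipschitz_def by blast
  have L: "L \<ge> 0" using lipS by (rule lipschitz_on_nonneg)
  obtain d where d: "d > 0" "ball p d \<subseteq> S"
    using S openE by blast
  \<comment> \<open>\<open>s\<close> will bound \<open>r\<close>: the last entry gives
    \<open>6 * L * s < 1\<close>, \<open>d\<close> keeps the ball inside \<open>S\<close>, and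
    \<open>1/2\<close> ensures \<open>s ^ 3 \<le> s\<close> and \<open>x$2 < x$1\<close>.\<close>
  define s where "s = min (1/2) (min d (1 / (6 * L + 1)))"
  have s: "0 < s" "s \<le> 1/2" "s \<le> d" "6 * L * s < 1"
  proof -
    show "0 < s" "s \<le> 1/2" "s \<le> d" using d L by (auto simp: s_def)
    have "s \<le> 1 / (6 * L + 1)" by (simp add: s_def)
    with L have "s * (6 * L + 1) \<le> 1" by (simp add: field_simps)
    with \<open>0 < s\<close> show "6 * L * s < 1" by (simp add: algebra_simps)
  qed
  have s3: "0 < s ^ 3" "s ^ 3 \<le> s"
    using s power_decreasing [of 1 3 s] by auto
  \<comment> \<open>A ball of radius \<open>s ^ 3 / 4\<close> about \<open>c\<close> stays in the
    strip \<open>0 < x$2 < s ^ 3\<close>, so that \<open>0 < r < s\<close>.\<close>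
  define c :: "real^2" where "c = vector [1, s ^ 3 / 2]"
  have pc: "norm (c - p) = s ^ 3 / 2"
    using s3 by (simp add: norm_eq_sqrt_inner inner_vec_def sum_2 c_def p_def
        power2_eq_square [symmetric])
  have "cball c (s ^ 3 / 4) \<subseteq> S"
  proof
    fix y assume "y \<in> cball c (s ^ 3 / 4)"
    then have "dist y c \<le> s ^ 3 / 4" by (simp add: dist_commute)
    then have "dist y p < d"
      using dist_triangle [of y p c] pc s3 s by (simp add: dist_norm)
    with d show "y \<in> S" by (auto simp: dist_commute)
  qed
  with lipS have "L-lipschitz_on (cball c (s ^ 3 / 4)) V"
    by (rule lipschitz_on_subset)
  then obtain x \<zeta> where x: "x \<in> ball c (s ^ 3 / 4)" and \<zeta>: "\<zeta> \<in> visc_subdiff V x"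
    and n: "norm \<zeta> \<le> 2 * L"
    using s3 by (elim lipschitz_bounded_visc_subgradient) auto
  have "\<bar>x$i - c$i\<bar> < s ^ 3 / 4" for i
    using component_le_norm_cart [of "x - c" i] x by (simp add: dist_norm norm_minus_commute)
  from this [of 1] this [of 2]
  have x1: "1/2 < x$1" and x2: "0 < x$2" "x$2 < s ^ 3" "x$2 < x$1"
    using s s3 unfolding c_def vector_2 by linarith+
  define r where "r = root 3 (x$2)"
  have r3: "r ^ 3 = x$2" by (simp add: r_def odd_real_root_pow)
  have r: "0 < r" "r < s"
    using x2 s r3 by (auto simp: r_def intro: power_less_imp_less_base [of _ 3])
  have "x \<noteq> 0" using x2 by auto
  \<comment> \<open>This first input component maximizes
    \<open>\<zeta>$1 * u$1 - (u$1)\<^sup>2\<close>; the resulting quarter of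
    \<open>(\<zeta>$1)\<^sup>2\<close> completes the square below.\<close>
  then have "\<zeta> \<bullet> Sigma3 x (vector [\<zeta>$1 / 2, 0])
      \<le> - (norm x)\<^sup>2 + (norm (vector [\<zeta>$1 / 2, 0] :: real^2))\<^sup>2"
    using V \<zeta> by (auto simp: dissip_set_def)
  then have "(\<zeta>$1 / 2 - (x$1 - x$2))\<^sup>2 + 2 * x$1 * x$2 \<le> \<zeta>$2 * (3 * r ^ 4 * (x$1 + x$2))"
    unfolding inner_Sigma3 norm_power2_vec2 r_def [symmetric]
    by (simp add: power2_eq_square algebra_simps)
  moreover have "\<zeta>$2 * (3 * r ^ 4 * (x$1 + x$2)) \<le> (2 * L) * (3 * r ^ 4 * (2 * x$1))"
    using component_le_norm_cart [of \<zeta> 2] n x1 x2 r L by (intro mult_mono) auto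
  ultimately have "2 * x$1 * x$2 \<le> (2 * L) * (3 * r ^ 4 * (2 * x$1))"
    by (smt (verit) zero_le_power2)
  also have "\<dots> = 2 * x$1 * x$2 * (6 * L * r)"
    by (simp add: r3 [symmetric] eval_nat_numeral)
  finally have "1 \<le> 6 * L * r"
    using x1 x2 by (simp add: mult_le_cancel_left1)
  also have "\<dots> \<le> 6 * L * s"
    using r L by (intro mult_left_mono) auto
  finally show False using s by simp
qed

theorem proposition2p4:
  "V3 \<in> dissip_set_inf Sigma3 UNIV 1 \<and>
   (\<forall>V \<in> dissip_set Sigma3 UNIV 1. locally_lipschitz V \<longrightarrow>
      \<not> pos_definite V \<and> \<not> proper_fun V)"
  using V3_in_dissip_set pos_definite_V3 proper_fun_V3 locally_lipschitz_not_in_dissip_set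
  by (auto simp: dissip_set_inf_def)

end
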